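(* Let $t_0>0$, $p>0$, $u_0>0$ be real numbers and let $\Gamma=\{(t_1,t_2): t_1\ge t_0,\ t_2\in[t_1,t_1+p]\}$. Let $F:[t_0,+\infty)\times\mathbb{R}\to[0,+\infty)$, $\alpha,\beta:[t_0,+\infty)\to[0,+\infty)$ and $\gamma:\Gamma\to[0,+\infty)$ be continuous functions, with $\alpha(t)\le\beta(t)$ for all $t\ge t_0$. Let $\mathcal{B}$ be the set of all $b\in C([t_0,+\infty),\mathbb{R})$ with $\alpha(t)\le b(t)\le\beta(t)$ for all $t\ge t_0$. Assume that: (i) $\lim_{t\to+\infty}\alpha(t)=\lim_{t\to+\infty}\beta(t)=0$ and $\alpha,\beta\in L^2((t_0,+\infty),\mathbb{R})$; (ii) for every $\varepsilon>0$ there exists $\zeta(\varepsilon)\in(0,p)$ such that $\gamma(t_1,t_2)<\varepsilon$ for all $(t_1,t_2)\in\Gamma$ with $0\le t_2-t_1\le\zeta(\varepsilon)$; (iii) for all $b\in\mathcal{B}$ and all $t\ge t_0$, $$B_-(t)\le\frac{1}{u_0}\int_t^{+\infty}F\left(s,u_0\exp\left(\int_{t_0}^s b(\tau)\,d\tau\right)\right)\exp\left(-\int_{t_0}^s b(\tau)\,d\tau\right)ds\le B_+(t),$$ where $B_-(t)=\alpha(t)-\int_t^{+\infty}[\alpha(s)]^2ds$ and $B_+(t)=\beta(t)-\int_t^{+\infty}[\beta(s)]^2ds$; (iv) for all $b\in\mathcal{B}$ and all $(t_1,t_2)\in\Gamma$, $$\frac{1}{u_0}\int_{t_1}^{t_2}F\left(s,u_0\exp\left(\int_{t_0}^s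 b(\tau)\,d\tau\right)\right)\exp\left(-\int_{t_0}^s b(\tau)\,d\tau\right)ds\le\gamma(t_1,t_2).$$ Then the problem $$\left\{\begin{array}{l}u''+F(t,u)=0,\quad t\ge t_0,\\ \alpha(t)\le\frac{u'(t)}{u(t)}\le\beta(t),\quad t\ge t_0,\\ \int_{t_1}^{t_2}\frac{F(s,u(s))}{u(s)}\,ds\le\gamma(t_1,t_2),\quad (t_1,t_2)\in\Gamma,\\ u(t_0)=u_0\end{array}\right.$$ has a (positive) solution $u$ on $[t_0,+\infty)$. In particular, its logarithmic derivative $u'/u$ lies in $\mathcal{B}$.
   Context: A solution of the problem is a twice continuously differentiable function $u:[t_0,+\infty)\to(0,+\infty)$ satisfying all the listed conditions. *)

theory Defs
  imports "HOL-Analysis.Analysis"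
begin

text \<open>
  Functions on \<open>[t0, \<infinity>)\<close> and on \<open>\<Gamma>\<close> are total functions constrained only on that domain.
  Integrals are Lebesgue integrals; a Bochner integral that does not exist has value 0 in the
  library, so convergence over unbounded intervals is required explicitly where it is not automatic.
\<close>

definition Gamma_set :: "real \<Rightarrow> real \<Rightarrow> (real \<times> real) set" where
  "Gamma_set t0 p = {(t1, t2). t0 \<le> t1 \<and> t2 \<in> {t1..t1 + p}}"

definition band :: "real \<Rightarrow> (real \<Rightarrow> real) \<Rightarrow> (real \<Rightarrow> real) \<Rightarrow> (real \<Rightarrow> real) set" where
  "band t0 \<alpha> \<beta> = {b. continuous_on {t0..} b \<and> (\<forall>t\<ge>t0. \<alpha> t \<le> b t \<and> b t \<le> \<beta> t)}"

definition L2_on :: "real set \<Rightarrow> (real \<Rightarrow> real) \<Rightarrow> bool" where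
  "L2_on S f \<longleftrightarrow> set_borel_measurable lborel S f \<and> set_integrable lborel S (\<lambda>t. (f t)\<^sup>2)"

definition B_bound :: "(real \<Rightarrow> real) \<Rightarrow> real \<Rightarrow> real" where
  "B_bound f t = f t - (LBINT s:{t..}. (f s)\<^sup>2)"

text \<open>For \<open>u = u0 * exp (\<integral> b)\<close> the following equals \<open>u0 * F (s, u s) / u s\<close>.\<close>

definition integrand ::
  "real \<Rightarrow> real \<Rightarrow> (real \<times> real \<Rightarrow> real) \<Rightarrow> (real \<Rightarrow> real) \<Rightarrow> real \<Rightarrow> real" where
  "integrand t0 u0 F b s =
     F (s, u0 * exp (LBINT \<tau>:{t0..s}. b \<tau>)) * exp (- (LBINT \<tau>:{t0..s}. b \<tau>))"

text \<open>
  \<open>u\<close> is twice continuously differentiable on \<open>[t0, \<infinity>)\<close> with derivatives \<open>u'\<close> and \<open>u''\<close>;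
  at \<open>t0\<close> the derivatives are one-sided.
\<close>

definition C2_from :: "real \<Rightarrow> (real \<Rightarrow> real) \<Rightarrow> (real \<Rightarrow> real) \<Rightarrow> (real \<Rightarrow> real) \<Rightarrow> bool" where
  "C2_from t0 u u' u'' \<longleftrightarrow>
     (\<forall>t\<ge>t0. (u has_real_derivative u' t) (at t within {t0..})) \<and>
     (\<forall>t\<ge>t0. (u' has_real_derivative u'' t) (at t within {t0..})) \<and>
     continuous_on {t0..} u''"

definition is_solution ::
  "real \<Rightarrow> real \<Rightarrow> real \<Rightarrow> (real \<times> real \<Rightarrow> real) \<Rightarrow> (real \<Rightarrow> real) \<Rightarrow> (real \<Rightarrow> real) \<Rightarrow>
   (real \<times> real \<Rightarrow> real) \<Rightarrow> (real \<Rightarrow> real) \<Rightarrow> (real \<Rightarrow> real) \<Rightarrow> (real \<Rightarrow> real) \<Rightarrow> bool" where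
  "is_solution t0 p u0 F \<alpha> \<beta> \<gamma> u u' u'' \<longleftrightarrow>
     C2_from t0 u u' u'' \<and>
     (\<forall>t\<ge>t0. u t > 0) \<and>
     (\<forall>t\<ge>t0. u'' t + F (t, u t) = 0) \<and>
     (\<forall>t\<ge>t0. \<alpha> t \<le> u' t / u t \<and> u' t / u t \<le> \<beta> t) \<and>
     (\<forall>(t1, t2)\<in>Gamma_set t0 p. (LBINT s:{t1..t2}. F (s, u s) / u s) \<le> \<gamma> (t1, t2)) \<and>
     u t0 = u0"

end

theory Submission
  imports Defs "HOL-Complex_Analysis.Great_Picard"
begin

text \<open>
  A positive \<open>u\<close> solves \<open>u'' + F (t, u) = 0\<close> exactly if its logarithmic derivative \<open>b = u' / u\<close> solves
  the Riccati equation \<open>b' = - b\<^sup>2 - F (t, u) / u\<close>, where \<open>u\<close> is recovered from \<open>b\<close> and \<open>u0\<close> as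
  \<open>u0 * exp (\<integral> b)\<close>. A solution \<open>b\<close> in the band tends to \<open>0\<close> at infinity, so integrating from \<open>t\<close>
  to infinity turns the equation into a fixed point problem \<open>b = riccati b\<close>. The right-hand side depends
  both on the past of \<open>b\<close>, through \<open>u\<close>, and on its future, through the integral, and \<open>F\<close> is neither
  monotone nor Lipschitz. Hence the fixed point comes from compactness and Brouwer's theorem.

  The hypotheses say precisely what such an argument needs. The tail bounds make the operator map the
  band into itself (\<open>riccati_range\<close>), the function \<open>\<gamma>\<close> makes its image equicontinuous
  (\<open>riccati_equicontinuous\<close>), and \<open>\<beta>\<close> tending to \<open>0\<close> controls the tails of the integrals, which gives
  continuity under pointwise convergence (\<open>riccati_tendsto\<close>).

  The fixed point theorem for bands, \<open>band_fixed_point\<close>, is a version of Schauder's theorem. Its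
  finite-dimensional core is stated for a product of countably many intervals (\<open>box_fixed_point\<close>) and
  follows from Kuhn's lemma. A function in the band is sampled at nodes and reconstructed by
  interpolation and clipping, which yields approximate fixed points; their images under the operator
  have a convergent subsequence because they are equicontinuous.
\<close>

section \<open>Fixed points in products of intervals\<close>

text \<open>
  Brouwer's theorem for the Hilbert cube, with faces allowed to degenerate. The cubes involved have
  as many coordinates as the approximation needs, so the dimension has to be a number rather than a
  type; Kuhn's combinatorial lemma provides this. At stage \<open>n\<close> the first \<open>n\<close> coordinates are
  divided into \<open>n + 1\<close> parts and the others are held at their left ends. A grid point gets label
  \<open>0\<close> in coordinate \<open>i\<close> if \<open>G\<close> does not decrease that coordinate and \<open>1\<close> if \<open>G\<close> does not increase
  it, so Kuhn's lemma yields a small cell in which every coordinate is pushed both ways. The cells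
  shrink to a point along a subsequence, and at that point \<open>G\<close> can move no coordinate at all.
\<close>

theorem box_fixed_point:
  fixes a b :: "nat \<Rightarrow> real" and G :: "(nat \<Rightarrow> real) \<Rightarrow> nat \<Rightarrow> real"
  assumes ab: "\<And>i. a i \<le> b i"
    and self: "\<And>x i. (\<And>j. x j \<in> {a j..b j}) \<Longrightarrow> G x i \<in> {a i..b i}"
    and cont: "\<And>X x i. \<lbrakk>\<And>k j. X k j \<in> {a j..b j}; \<And>j. x j \<in> {a j..b j};
                 \<And>j. (\<lambda>k. X k j) \<longlonglongrightarrow> x j\<rbrakk> \<Longrightarrow> (\<lambda>k. G (X k) i) \<longlonglongrightarrow> G x i"
  obtains x where "\<And>i. x i \<in> {a i..b i}" and "\<And>i. G x i = x i"
proof -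
  \<comment> \<open>The truncation by \<open>Suc n\<close> makes every \<open>e n y\<close> a point of the box, whatever \<open>y\<close> is.\<close>
  define e where "e n y j = (if j < n then a j + (b j - a j) * (real (min (y j) (Suc n)) / Suc n) else a j)"
    for n and y :: "nat \<Rightarrow> nat" and j
  have e_box: "e n y j \<in> {a j..b j}" for n y j
  proof -
    have "(b j - a j) * (real (min (y j) (Suc n)) / Suc n) \<le> (b j - a j) * 1"
      using ab[of j] by (intro mult_left_mono) auto
    moreover have "0 \<le> (b j - a j) * (real (min (y j) (Suc n)) / Suc n)"
      using ab[of j] by simp
    ultimately show ?thesis using ab[of j] by (auto simp: e_def)
  qed
  have "\<exists>q r s. \<forall>i<n. (\<forall>j<n. q j \<le> r i j \<and> r i j \<le> q j + 1) \<and> (\<forall>j<n. q j \<le> s i j \<and> s i j \<le> q j + 1)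
      \<and> q i \<le> n \<and> e n (r i) i \<le> G (e n (r i)) i \<and> G (e n (s i)) i \<le> e n (s i) i" for n
  proof -
    \<comment> \<open>Kuhn's lemma prescribes the labels on the faces; \<open>G\<close> maps into the box, so they keep their meaning there.\<close>
    define label where "label y i = (if y i = 0 \<or> (y i \<noteq> Suc n \<and> e n y i \<le> G (e n y) i) then 0 else 1 :: nat)"
      for y i
    have up: "e n y i \<le> G (e n y) i" if "label y i = 0" "i < n" for y i
    proof (cases "y i = 0")
      case True
      then have "e n y i = a i" by (simp add: e_def)
      then show ?thesis using self[of "e n y" i] e_box by auto
    qed (use that in \<open>auto simp: label_def split: if_splits\<close>)
    have down: "G (e n y) i \<le> e n y i" if "label y i \<noteq> 0" "i < n" for y i
    proof (cases "y i = Suc n")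
      case True
      then have "e n y i = b i" using that by (simp add: e_def)
      then show ?thesis using self[of "e n y" i] e_box by auto
    qed (use that in \<open>auto simp: label_def split: if_splits\<close>)
    obtain q where q: "\<forall>i<n. q i < Suc n"
      and rs: "\<forall>i<n. \<exists>r s. (\<forall>j<n. q j \<le> r j \<and> r j \<le> q j + 1) \<and> (\<forall>j<n. q j \<le> s j \<and> s j \<le> q j + 1) \<and> label r i \<noteq> label s i"
      by (rule kuhn_lemma[of "Suc n" n label]) (auto simp: label_def)
    have "\<exists>r s. (\<forall>j<n. q j \<le> r j \<and> r j \<le> q j + 1) \<and> (\<forall>j<n. q j \<le> s j \<and> s j \<le> q j + 1)
      \<and> q i \<le> n \<and> e n r i \<le> G (e n r) i \<and> G (e n s) i \<le> e n s i" if i: "i < n" for i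
    proof -
      obtain r s where 1: "\<forall>j<n. q j \<le> r j \<and> r j \<le> q j + 1" "\<forall>j<n. q j \<le> s j \<and> s j \<le> q j + 1"
        and "label r i \<noteq> label s i"
        using rs i by blast
      have "label y i = 0 \<or> label y i = 1" for y
        by (simp add: label_def)
      then have "label r i = 0 \<and> label s i \<noteq> 0 \<or> label r i \<noteq> 0 \<and> label s i = 0"
        using \<open>label r i \<noteq> label s i\<close> by metis
      moreover have "q i \<le> n"
        using q i by auto
      ultimately show ?thesis
        using 1 up[of _ i] down[of _ i] i by blast
    qed
    then show ?thesis by metis
  qed
  then obtain q r s where qrs: "\<And>n i. i < n \<Longrightarrow> (\<forall>j<n. q n j \<le> r n i j \<and> r n i j \<le> q n j + 1) \<and>
      (\<forall>j<n. q n j \<le> s n i j \<and> s n i j \<le> q n j + 1) \<and> q n i \<le> n \<and>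
      e n (r n i) i \<le> G (e n (r n i)) i \<and> G (e n (s n i)) i \<le> e n (s n i) i"
    by metis
  \<comment> \<open>The cells are compared through rescaled coordinates in \<open>[0, 1]\<close>, where one bound serves all \<open>j\<close>.\<close>
  define y where "y n j = (if j < n then real (q n j) / Suc n else 0)" for n j
  obtain k :: "nat \<Rightarrow> nat" where k: "strict_mono k" "\<And>j. j \<in> UNIV \<Longrightarrow> \<exists>l. (\<lambda>n. y (k n) j) \<longlonglongrightarrow> l"
  proof (rule function_convergent_subsequence[of UNIV y 1])
    show "norm (y n j) \<le> 1" for n j
      using qrs[of j n] by (auto simp: y_def)
  qed auto
  then obtain l where l: "\<And>j. (\<lambda>n. y (k n) j) \<longlonglongrightarrow> l j" by (metis UNIV_I)
  define x where "x j = a j + (b j - a j) * l j" for j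
  have k_gt: "\<forall>\<^sub>F n in sequentially. m < k n" for m
    using eventually_gt_at_top[of m] by eventually_elim (use seq_suble[OF k(1)] less_le_trans in blast)
  \<comment> \<open>Corners of the cells chosen by Kuhn's lemma all converge to the same point.\<close>
  have near: "(\<lambda>n. e (k n) (v (k n)) j) \<longlonglongrightarrow> x j"
    if v: "\<And>n j. i < n \<Longrightarrow> j < n \<Longrightarrow> q n j \<le> v n j \<and> v n j \<le> q n j + 1" for i v j
  proof -
    have ev: "\<forall>\<^sub>F n in sequentially. i < k n \<and> j < k n"
      by (intro eventually_conj k_gt)
    have "\<forall>\<^sub>F n in sequentially. \<bar>e (k n) (v (k n)) j - (a j + (b j - a j) * y (k n) j)\<bar> \<le> (b j - a j) * (1 / Suc (k n))"
      using ev
    proof eventually_elim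
      case (elim n)
      then have *: "q (k n) j \<le> v (k n) j" "v (k n) j \<le> q (k n) j + 1" "q (k n) j \<le> k n"
        using v qrs by blast+
      have "\<bar>e (k n) (v (k n)) j - (a j + (b j - a j) * y (k n) j)\<bar> =
         \<bar>(b j - a j) * ((real (v (k n) j) - real (q (k n) j)) / Suc (k n))\<bar>"
        using elim * by (simp add: e_def y_def min_def algebra_simps diff_divide_distrib)
      also have "\<dots> = (b j - a j) * \<bar>(real (v (k n) j) - real (q (k n) j)) / Suc (k n)\<bar>"
        using ab[of j] by (simp add: abs_mult)
      also have "\<dots> \<le> (b j - a j) * (1 / Suc (k n))"
        using ab[of j] * by (intro mult_left_mono) (auto simp: divide_simps)
      finally show ?case .
    qed
    moreover have "(\<lambda>n. 1 / real (Suc (k n))) \<longlonglongrightarrow> 0"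
      using LIMSEQ_subseq_LIMSEQ[OF LIMSEQ_inverse_real_of_nat k(1)] by (simp add: comp_def inverse_eq_divide)
    then have "(\<lambda>n. (b j - a j) * (1 / real (Suc (k n)))) \<longlonglongrightarrow> 0"
      by (rule tendsto_mult_right_zero)
    ultimately have "(\<lambda>n. e (k n) (v (k n)) j - (a j + (b j - a j) * y (k n) j)) \<longlonglongrightarrow> 0"
      unfolding real_norm_def[symmetric] by (rule Lim_null_comparison)
    moreover have "(\<lambda>n. a j + (b j - a j) * y (k n) j) \<longlonglongrightarrow> x j"
      unfolding x_def by (intro tendsto_intros l)
    ultimately show ?thesis by (rule Lim_transform[rotated])
  qed
  have x_box: "x i \<in> {a i..b i}" for i
    by (rule closed_sequentially[OF closed_atLeastAtMost _ near[of 0 q]]) (use e_box in auto)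
  have "G x i = x i" for i
  proof (rule antisym)
    have R: "(\<lambda>n. e (k n) (r (k n) i) j) \<longlonglongrightarrow> x j" for j
      by (rule near[of i "\<lambda>n. r n i"]) (use qrs in blast)
    have S: "(\<lambda>n. e (k n) (s (k n) i) j) \<longlonglongrightarrow> x j" for j
      by (rule near[of i "\<lambda>n. s n i"]) (use qrs in blast)
    show "x i \<le> G x i"
      by (rule tendsto_le[OF _ cont[OF _ _ R] R]) (use e_box x_box qrs k_gt[of i] in \<open>auto elim!: eventually_mono\<close>)
    show "G x i \<le> x i"
      by (rule tendsto_le[OF _ S cont[OF _ _ S]]) (use e_box x_box qrs k_gt[of i] in \<open>auto elim!: eventually_mono\<close>)
  qed
  with x_box that show ?thesis by blast
qed

section \<open>Fixed points in bands of functions\<close>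

text \<open>
  Values prescribed at finitely many nodes are interpolated with hat functions normalised by their
  sum, and the result is clipped to lie between \<open>\<alpha>\<close> and \<open>\<beta>\<close>; this turns each point of a box into a
  member of the band. The map that sends prescribed values to the values of \<open>T\<close> at the nodes then has
  a fixed point, at which the prescribed values are those of \<open>T b\<close> itself. Since \<open>T b\<close> varies by
  less than \<open>\<epsilon>\<close> over the support of a hat, the interpolant is \<open>\<epsilon>\<close>-close to \<open>T b\<close>, and clipping
  cannot increase the distance to \<open>T b\<close>, which already lies between \<open>\<alpha>\<close> and \<open>\<beta>\<close>.
\<close>

lemma band_approximate_fixed_point:
  fixes t0 R \<epsilon> :: real and T :: "(real \<Rightarrow> real) \<Rightarrow> real \<Rightarrow> real"
  assumes "continuous_on {t0..} \<alpha>" "continuous_on {t0..} \<beta>"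
    and le: "\<And>t. t \<ge> t0 \<Longrightarrow> \<alpha> t \<le> \<beta> t"
    and range: "\<And>b t. b \<in> band t0 \<alpha> \<beta> \<Longrightarrow> t \<ge> t0 \<Longrightarrow> T b t \<in> {\<alpha> t..\<beta> t}"
    and equi: "\<And>\<epsilon>. \<epsilon> > 0 \<Longrightarrow> \<exists>\<delta>>0. \<forall>b\<in>band t0 \<alpha> \<beta>. \<forall>s\<ge>t0. \<forall>t\<ge>t0. \<bar>t - s\<bar> < \<delta> \<longrightarrow> \<bar>T b t - T b s\<bar> < \<epsilon>"
    and cont: "\<And>B b t. \<lbrakk>\<And>n. B n \<in> band t0 \<alpha> \<beta>; b \<in> band t0 \<alpha> \<beta>;
          \<And>t. t \<ge> t0 \<Longrightarrow> (\<lambda>n. B n t) \<longlonglongrightarrow> b t; t \<ge> t0\<rbrakk> \<Longrightarrow> (\<lambda>n. T (B n) t) \<longlonglongrightarrow> T b t"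
    and "\<epsilon> > 0"
  obtains b where "b \<in> band t0 \<alpha> \<beta>" and "\<And>t. t \<in> {t0..R} \<Longrightarrow> \<bar>b t - T b t\<bar> \<le> \<epsilon>"
proof -
  obtain \<delta> where "\<delta> > 0" and \<delta>: "\<And>b s t. \<lbrakk>b \<in> band t0 \<alpha> \<beta>; s \<ge> t0; t \<ge> t0; \<bar>t - s\<bar> < \<delta>\<rbrakk> \<Longrightarrow> \<bar>T b t - T b s\<bar> < \<epsilon>"
    using equi[OF \<open>\<epsilon> > 0\<close>] by blast
  define \<tau> where "\<tau> i = t0 + real i * (\<delta> / 2)" for i
  define N where "N = nat \<lfloor>(R - t0) / (\<delta> / 2)\<rfloor>"
  define \<phi> where "\<phi> i t = max 0 (\<delta> - \<bar>t - \<tau> i\<bar>)" for i t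
  \<comment> \<open>The second term vanishes on \<open>{t0..R}\<close> and keeps the denominator positive beyond \<open>R\<close>.\<close>
  define D where "D t = (\<Sum>i\<le>N. \<phi> i t) + max 0 (t - R)" for t
  define S where "S x t = (\<Sum>i\<le>N. \<phi> i t * x i) / D t" for x t
  define clip where "clip x t = max (\<alpha> t) (min (\<beta> t) (S x t))" for x t
  have \<tau>: "\<tau> i \<ge> t0" for i
    using \<open>\<delta> > 0\<close> by (simp add: \<tau>_def)
  have \<phi>: "\<phi> i t \<ge> 0" for i t
    by (simp add: \<phi>_def)
  have D: "D t > 0" if "t \<ge> t0" for t
  proof (cases "t \<le> R")
    case True
    define i where "i = nat \<lfloor>(t - t0) / (\<delta> / 2)\<rfloor>"
    have "i \<le> N"
      unfolding i_def N_def using True \<open>\<delta> > 0\<close> by (intro nat_mono floor_mono divide_right_mono) auto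
    have "real i \<le> (t - t0) / (\<delta> / 2)" "(t - t0) / (\<delta> / 2) < real i + 1"
      using that \<open>\<delta> > 0\<close> by (simp_all add: i_def)
    then have "real i * (\<delta> / 2) \<le> t - t0" "t - t0 < (real i + 1) * (\<delta> / 2)"
      using \<open>\<delta> > 0\<close> by (simp_all only: pos_le_divide_eq pos_divide_less_eq half_gt_zero)
    then have "0 < \<phi> i t"
      using \<open>\<delta> > 0\<close> by (simp add: \<phi>_def \<tau>_def abs_if algebra_simps)
    also have "\<dots> \<le> (\<Sum>i\<le>N. \<phi> i t)"
      using \<open>i \<le> N\<close> \<phi> by (intro member_le_sum) auto
    finally show ?thesis by (simp add: D_def)
  next
    case False
    then show ?thesis using sum_nonneg[of "{..N}" "\<lambda>i. \<phi> i t"] \<phi> by (simp add: D_def)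
  qed
  have clip_band: "clip x \<in> band t0 \<alpha> \<beta>" for x
  proof -
    have "continuous_on {t0..} (S x)"
      unfolding S_def D_def \<phi>_def
      by (intro continuous_intros) (use D in \<open>force simp: D_def \<phi>_def\<close>)
    then show ?thesis
      using assms(1,2) le by (auto simp: band_def clip_def intro!: continuous_intros)
  qed
  have clip_lim: "(\<lambda>k. clip (X k) t) \<longlonglongrightarrow> clip x t" if "\<And>j. (\<lambda>k. X k j) \<longlonglongrightarrow> x j" "t \<ge> t0" for X x t
    unfolding clip_def S_def using D[OF that(2)] by (intro tendsto_intros that(1)) auto
  \<comment> \<open>There is one coordinate for every \<open>i\<close>, but \<open>clip x\<close> depends only on those up to \<open>N\<close>.\<close>
  obtain x where x: "\<And>i. T (clip x) (\<tau> i) = x i"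
  proof (rule box_fixed_point[of "\<lambda>i. \<alpha> (\<tau> i)" "\<lambda>i. \<beta> (\<tau> i)" "\<lambda>x i. T (clip x) (\<tau> i)"])
    show "(\<lambda>k. T (clip (X k)) (\<tau> i)) \<longlonglongrightarrow> T (clip x) (\<tau> i)" if "\<And>j. (\<lambda>k. X k j) \<longlonglongrightarrow> x j" for X x i
      by (intro cont clip_band clip_lim that \<tau>)
  qed (use le \<tau> range clip_band in auto)
  show ?thesis
  proof (rule that[OF clip_band])
    fix t assume t: "t \<in> {t0..R}"
    let ?y = "T (clip x) t"
    have Dt: "D t = (\<Sum>i\<le>N. \<phi> i t)" using t by (simp add: D_def)
    have "(\<Sum>i\<le>N. \<phi> i t * (x i - ?y)) = (\<Sum>i\<le>N. \<phi> i t * x i) - D t * ?y"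
      by (simp add: Dt right_diff_distrib sum_subtractf sum_distrib_right)
    then have "S x t - ?y = (\<Sum>i\<le>N. \<phi> i t * (x i - ?y)) / D t"
      using D[of t] t by (simp add: S_def diff_divide_distrib)
    also have "\<bar>\<dots>\<bar> \<le> (\<Sum>i\<le>N. \<phi> i t * \<epsilon>) / D t"
    proof -
      have "\<bar>\<phi> i t * (x i - ?y)\<bar> \<le> \<phi> i t * \<epsilon>" for i
      proof (cases "\<bar>t - \<tau> i\<bar> < \<delta>")
        case True
        then have "\<bar>x i - ?y\<bar> \<le> \<epsilon>"
          using \<delta>[OF clip_band \<tau>, of t i x] t x[of i] by auto
        then show ?thesis using \<phi> by (auto simp: abs_mult intro: mult_left_mono)
      qed (simp add: \<phi>_def)
      then have "\<bar>\<Sum>i\<le>N. \<phi> i t * (x i - ?y)\<bar> \<le> (\<Sum>i\<le>N. \<phi> i t * \<epsilon>)"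
        by (intro order_trans[OF sum_abs] sum_mono)
      then show ?thesis
        using D[of t] t by (auto simp: abs_divide intro: divide_right_mono)
    qed
    also have "\<dots> = \<epsilon>"
      using D[of t] t by (simp add: Dt flip: sum_distrib_right)
    finally have "\<bar>S x t - ?y\<bar> \<le> \<epsilon>" .
    then show "\<bar>clip x t - ?y\<bar> \<le> \<epsilon>"
      using range[OF clip_band, of t x] t by (auto simp: clip_def max_def min_def abs_if split: if_splits)
  qed
qed

text \<open>
  A Schauder theorem for bands of functions on a half-line. The images \<open>T (B n)\<close> of better and better
  approximate fixed points \<open>B n\<close> are equicontinuous, so a subsequence that converges at all rational
  points converges everywhere, to a continuous function. The \<open>B n\<close> themselves have the same limit,
  and continuity of \<open>T\<close> under pointwise convergence makes it a fixed point.
\<close>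

theorem band_fixed_point:
  fixes t0 :: real and T :: "(real \<Rightarrow> real) \<Rightarrow> real \<Rightarrow> real"
  assumes "continuous_on {t0..} \<alpha>" "continuous_on {t0..} \<beta>"
    and le: "\<And>t. t \<ge> t0 \<Longrightarrow> \<alpha> t \<le> \<beta> t"
    and range: "\<And>b t. b \<in> band t0 \<alpha> \<beta> \<Longrightarrow> t \<ge> t0 \<Longrightarrow> T b t \<in> {\<alpha> t..\<beta> t}"
    and equi: "\<And>\<epsilon>. \<epsilon> > 0 \<Longrightarrow> \<exists>\<delta>>0. \<forall>b\<in>band t0 \<alpha> \<beta>. \<forall>s\<ge>t0. \<forall>t\<ge>t0. \<bar>t - s\<bar> < \<delta> \<longrightarrow> \<bar>T b t - T b s\<bar> < \<epsilon>"
    and cont: "\<And>B b t. \<lbrakk>\<And>n. B n \<in> band t0 \<alpha> \<beta>; b \<in> band t0 \<alpha> \<beta>;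
          \<And>t. t \<ge> t0 \<Longrightarrow> (\<lambda>n. B n t) \<longlonglongrightarrow> b t; t \<ge> t0\<rbrakk> \<Longrightarrow> (\<lambda>n. T (B n) t) \<longlonglongrightarrow> T b t"
  obtains b where "b \<in> band t0 \<alpha> \<beta>" and "\<And>t. t \<ge> t0 \<Longrightarrow> T b t = b t"
proof -
  have "\<exists>b. b \<in> band t0 \<alpha> \<beta> \<and> (\<forall>t\<in>{t0..real n}. \<bar>b t - T b t\<bar> \<le> inverse (Suc n))" for n
    by (rule band_approximate_fixed_point[OF assms, of "inverse (Suc n)" "real n"]) auto
  then obtain B where B: "\<And>n. B n \<in> band t0 \<alpha> \<beta>"
    and approx: "\<And>n t. t \<in> {t0..real n} \<Longrightarrow> \<bar>B n t - T (B n) t\<bar> \<le> inverse (Suc n)"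
    by metis
  \<comment> \<open>\<open>\<alpha>\<close> and \<open>\<beta>\<close> may be unbounded; dividing by \<open>w\<close> gives a bound that holds at all points at once.\<close>
  define w where "w q = 1 + \<bar>\<alpha> q\<bar> + \<bar>\<beta> q\<bar>" for q
  have w: "w q > 0" for q
    by (simp add: w_def add_pos_nonneg)
  obtain k where k: "strict_mono (k :: nat \<Rightarrow> nat)"
    and lim_rat: "\<And>q. q \<in> \<rat> \<inter> {t0..} \<Longrightarrow> \<exists>l. (\<lambda>n. T (B (k n)) q / w q) \<longlonglongrightarrow> l"
  proof (rule function_convergent_subsequence[of "\<rat> \<inter> {t0..}" "\<lambda>n q. T (B n) q / w q" 1])
    show "norm (T (B n) q / w q) \<le> 1" if "q \<in> \<rat> \<inter> {t0..}" for n q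
      using range[OF B, of q n] that w[of q] by (auto simp: abs_divide divide_le_eq_1 w_def)
  qed (auto simp: countable_rat)
  have "convergent (\<lambda>n. T (B (k n)) t)" if t: "t \<ge> t0" for t
  proof (rule Cauchy_convergent, rule CauchyI)
    fix e :: real assume "e > 0"
    then obtain d where "d > 0" and d: "\<And>b s t. \<lbrakk>b \<in> band t0 \<alpha> \<beta>; s \<ge> t0; t \<ge> t0; \<bar>t - s\<bar> < d\<rbrakk> \<Longrightarrow> \<bar>T b t - T b s\<bar> < e / 3"
      using equi[of "e / 3"] by auto
    obtain q where q: "q \<in> \<rat>" "t < q" "q < t + d"
      using Rats_dense_in_real[of t "t + d"] \<open>d > 0\<close> by auto
    obtain l where "(\<lambda>n. T (B (k n)) q / w q) \<longlonglongrightarrow> l"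
      using lim_rat[of q] q t by auto
    then have "(\<lambda>n. T (B (k n)) q / w q * w q) \<longlonglongrightarrow> l * w q"
      by (rule tendsto_mult_right)
    then have "Cauchy (\<lambda>n. T (B (k n)) q)"
      using w[of q] by (auto intro: LIMSEQ_imp_Cauchy)
    then obtain M where M: "\<And>m n. m \<ge> M \<Longrightarrow> n \<ge> M \<Longrightarrow> \<bar>T (B (k m)) q - T (B (k n)) q\<bar> < e / 3"
      using CauchyD[of "\<lambda>n. T (B (k n)) q" "e / 3"] \<open>e > 0\<close> unfolding real_norm_def by (metis zero_less_divide_iff zero_less_numeral)
    have "\<bar>T (B (k m)) t - T (B (k n)) t\<bar> < e" if "m \<ge> M" "n \<ge> M" for m n
    proof -
      have "t0 \<le> q" "\<bar>q - t\<bar> < d" using q t by auto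
      then show ?thesis
        using M[OF that] d[OF B t, of q "k m"] d[OF B t, of q "k n"] by linarith
    qed
    then show "\<exists>M. \<forall>m\<ge>M. \<forall>n\<ge>M. norm (T (B (k m)) t - T (B (k n)) t) < e"
      by (auto simp: real_norm_def)
  qed
  then obtain b where b: "\<And>t. t \<ge> t0 \<Longrightarrow> (\<lambda>n. T (B (k n)) t) \<longlonglongrightarrow> b t"
    unfolding convergent_def by metis
  have B_lim: "(\<lambda>n. B (k n) t) \<longlonglongrightarrow> b t" if t: "t \<ge> t0" for t
  proof -
    have "\<forall>\<^sub>F n in sequentially. t \<le> real n"
      using real_arch_simple[of t] by (meson eventually_sequentiallyI of_nat_mono order_trans)
    then have "\<forall>\<^sub>F n in sequentially. norm (B n t - T (B n) t) \<le> inverse (Suc n)"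
      by eventually_elim (use approx t in auto)
    then have "(\<lambda>n. B n t - T (B n) t) \<longlonglongrightarrow> 0"
      using LIMSEQ_inverse_real_of_nat by (rule Lim_null_comparison)
    then have "(\<lambda>n. B (k n) t - T (B (k n)) t) \<longlonglongrightarrow> 0"
      using LIMSEQ_subseq_LIMSEQ[OF _ k] unfolding comp_def by blast
    then show ?thesis
      by (rule Lim_transform[OF b[OF t]])
  qed
  have b_range: "b t \<in> {\<alpha> t..\<beta> t}" if "t \<ge> t0" for t
    by (rule closed_sequentially[OF closed_atLeastAtMost _ b[OF that]]) (use range[OF B that] in auto)
  have "continuous_on {t0..} b"
    unfolding continuous_on_iff dist_real_def
  proof (intro ballI allI impI)
    fix s e :: real assume "s \<in> {t0..}" and "0 < e"
    then have "t0 \<le> s" by simp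
    obtain d where "d > 0" and d: "\<And>b s t. \<lbrakk>b \<in> band t0 \<alpha> \<beta>; s \<ge> t0; t \<ge> t0; \<bar>t - s\<bar> < d\<rbrakk> \<Longrightarrow> \<bar>T b t - T b s\<bar> < e / 2"
      using equi[of "e / 2"] \<open>0 < e\<close> by auto
    have "\<bar>b t - b s\<bar> < e" if "t \<ge> t0" "\<bar>t - s\<bar> < d" for t
    proof -
      have "(\<lambda>n. \<bar>T (B (k n)) t - T (B (k n)) s\<bar>) \<longlonglongrightarrow> \<bar>b t - b s\<bar>"
        by (intro tendsto_intros b that \<open>t0 \<le> s\<close>)
      then have "\<bar>b t - b s\<bar> \<le> e / 2"
        by (rule LIMSEQ_le_const2) (use d[OF B \<open>t0 \<le> s\<close> that] in \<open>auto intro: less_imp_le\<close>)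
      then show ?thesis using \<open>0 < e\<close> by simp
    qed
    then show "\<exists>d>0. \<forall>t\<in>{t0..}. \<bar>t - s\<bar> < d \<longrightarrow> \<bar>b t - b s\<bar> < e"
      using \<open>d > 0\<close> by auto
  qed
  then have b_band: "b \<in> band t0 \<alpha> \<beta>"
    using b_range by (auto simp: band_def)
  have "T b t = b t" if "t \<ge> t0" for t
    using cont[of "\<lambda>n. B (k n)" b t, OF B b_band B_lim that] b[OF that] by (rule LIMSEQ_unique)
  with b_band that show ?thesis by blast
qed

section \<open>Integrals of continuous functions\<close>

lemma LBINT_has_real_derivative:
  fixes g :: "real \<Rightarrow> real"
  assumes "continuous_on {a..} g" and "t \<ge> a"
  shows "((\<lambda>x. LBINT s:{a..x}. g s) has_real_derivative g t) (at t within {a..})"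
proof -
  have cont: "continuous_on {a..x} g" for x
    using assms(1) by (rule continuous_on_subset) auto
  have "(\<lambda>x. LBINT s:{a..x}. g s) = (\<lambda>x. integral {a..x} g)"
    by (intro ext set_borel_integral_eq_integral(2) borel_integrable_atLeastAtMost' cont)
  moreover have "((\<lambda>x. integral {a..x} g) has_real_derivative g t) (at t within {a..t + 1})"
    using assms(2) by (intro integral_has_real_derivative cont) auto
  moreover have "at t within {a..t + 1} = at t within {a..}"
    by (rule at_within_nhd[of _ "{..<t + 1}"]) auto
  ultimately show ?thesis by simp
qed

lemma LBINT_bounded_convergence:
  fixes f :: "nat \<Rightarrow> real \<Rightarrow> real"
  assumes f: "\<And>n. continuous_on {a..c} (f n)" and g: "continuous_on {a..c} g"
    and lim: "\<And>s. s \<in> {a..c} \<Longrightarrow> (\<lambda>n. f n s) \<longlonglongrightarrow> g s"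
    and bound: "\<And>n s. s \<in> {a..c} \<Longrightarrow> \<bar>f n s\<bar> \<le> K"
  shows "(\<lambda>n. LBINT s:{a..c}. f n s) \<longlonglongrightarrow> (LBINT s:{a..c}. g s)"
  unfolding set_lebesgue_integral_def
proof (rule integral_dominated_convergence[where w = "\<lambda>s. indicator {a..c} s *\<^sub>R K"])
  show "(\<lambda>s. indicator {a..c} s *\<^sub>R g s) \<in> borel_measurable lborel"
    using borel_integrable_atLeastAtMost'[OF g] unfolding set_integrable_def by (rule borel_measurable_integrable)
  show "(\<lambda>s. indicator {a..c} s *\<^sub>R f n s) \<in> borel_measurable lborel" for n
    using borel_integrable_atLeastAtMost'[OF f] unfolding set_integrable_def by (rule borel_measurable_integrable)
  show "integrable lborel (\<lambda>s. indicator {a..c} s *\<^sub>R K)"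
    using borel_integrable_atLeastAtMost'[of a c "\<lambda>_. K"] by (simp add: set_integrable_def)
  show "AE s in lborel. (\<lambda>n. indicator {a..c} s *\<^sub>R f n s) \<longlonglongrightarrow> indicator {a..c} s *\<^sub>R g s"
    by (intro AE_I2) (auto simp: indicator_def lim)
  show "AE s in lborel. norm (indicator {a..c} s *\<^sub>R f n s) \<le> indicator {a..c} s *\<^sub>R K" for n
    by (intro AE_I2) (use bound in \<open>auto simp: indicator_def\<close>)
qed

text \<open>Square integrability is only assumed on the open half-line; the end point is a null set.\<close>

lemma L2_on_square_integrable:
  assumes "L2_on {a<..} f" and "t \<ge> a"
  shows "set_integrable lborel {t..} (\<lambda>s. (f s)\<^sup>2)"
proof -
  have "set_integrable lborel {t<..} (\<lambda>s. (f s)\<^sup>2)"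
    by (rule set_integrable_subset[of _ "{a<..}"]) (use assms in \<open>auto simp: L2_on_def\<close>)
  then show ?thesis
    by (subst set_integrable_discrete_difference[of "{t}" _ "{t<..}"]) auto
qed

section \<open>The Riccati operator\<close>

text \<open>
  The hypotheses of the existence theorem, as a context for the operator whose fixed points are the
  logarithmic derivatives of solutions.
\<close>

locale riccati_band =
  fixes t0 p u0 :: real
    and F :: "real \<times> real \<Rightarrow> real"
    and \<alpha> \<beta> :: "real \<Rightarrow> real"
    and \<gamma> :: "real \<times> real \<Rightarrow> real"
  assumes u0_pos: "u0 > 0"
    and F_cont: "continuous_on ({t0..} \<times> UNIV) F"
    and F_nonneg: "\<And>t x. t \<ge> t0 \<Longrightarrow> F (t, x) \<ge> 0"
    and alpha_cont: "continuous_on {t0..} \<alpha>"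
    and alpha_nonneg: "\<And>t. t \<ge> t0 \<Longrightarrow> \<alpha> t \<ge> 0"
    and beta_cont: "continuous_on {t0..} \<beta>"
    and alpha_le_beta: "\<And>t. t \<ge> t0 \<Longrightarrow> \<alpha> t \<le> \<beta> t"
    and beta_lim: "(\<beta> \<longlongrightarrow> 0) at_top"
    and alpha_L2: "L2_on {t0<..} \<alpha>" and beta_L2: "L2_on {t0<..} \<beta>"
    and gamma_small: "\<And>\<epsilon>. \<epsilon> > 0 \<Longrightarrow> \<exists>\<zeta>. 0 < \<zeta> \<and> \<zeta> < p \<and>
        (\<forall>(t1, t2)\<in>Gamma_set t0 p. 0 \<le> t2 - t1 \<and> t2 - t1 \<le> \<zeta> \<longrightarrow> \<gamma> (t1, t2) < \<epsilon>)"
    and tail_bounds: "\<And>b t. b \<in> band t0 \<alpha> \<beta> \<Longrightarrow> t \<ge> t0 \<Longrightarrow>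
        set_integrable lborel {t..} (integrand t0 u0 F b) \<and>
        B_bound \<alpha> t \<le> 1 / u0 * (LBINT s:{t..}. integrand t0 u0 F b s) \<and>
        1 / u0 * (LBINT s:{t..}. integrand t0 u0 F b s) \<le> B_bound \<beta> t"
    and gamma_bound: "\<And>b t1 t2. b \<in> band t0 \<alpha> \<beta> \<Longrightarrow> (t1, t2) \<in> Gamma_set t0 p \<Longrightarrow>
        1 / u0 * (LBINT s:{t1..t2}. integrand t0 u0 F b s) \<le> \<gamma> (t1, t2)"
begin

definition primitive :: "(real \<Rightarrow> real) \<Rightarrow> real \<Rightarrow> real" where
  "primitive b t = (LBINT s:{t0..t}. b s)"

text \<open>
  With \<open>u = u0 * exp (primitive b)\<close> the integrand divided by \<open>u0\<close> is \<open>F (s, u s) / u s\<close>, so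
  \<open>u'' + F (t, u) = 0\<close> is the Riccati equation \<open>b' = - rate b\<close>.
\<close>

definition rate :: "(real \<Rightarrow> real) \<Rightarrow> real \<Rightarrow> real" where
  "rate b s = (b s)\<^sup>2 + integrand t0 u0 F b s / u0"

text \<open>
  The Riccati equation integrated from \<open>t\<close> to infinity, with the boundary condition that \<open>b\<close> tends to
  \<open>0\<close>, which every member of the band satisfies.
\<close>

definition riccati :: "(real \<Rightarrow> real) \<Rightarrow> real \<Rightarrow> real" where
  "riccati b t = (LBINT s:{t..}. rate b s)"

lemma integrand_primitive:
  "integrand t0 u0 F b s = F (s, u0 * exp (primitive b s)) * exp (- primitive b s)"
  by (simp add: integrand_def primitive_def)

lemma band_cont: "b \<in> band t0 \<alpha> \<beta> \<Longrightarrow> continuous_on {t0..} b"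
  by (simp add: band_def)

lemma band_range:
  assumes "b \<in> band t0 \<alpha> \<beta>" "t \<ge> t0"
  shows "0 \<le> b t" "\<alpha> t \<le> b t" "b t \<le> \<beta> t"
  using assms alpha_nonneg[of t] by (auto simp: band_def)

lemma band_square:
  assumes b: "b \<in> band t0 \<alpha> \<beta>" and t: "t \<ge> t0"
  shows "(\<alpha> t)\<^sup>2 \<le> (b t)\<^sup>2" "(b t)\<^sup>2 \<le> (\<beta> t)\<^sup>2"
  using band_range[OF b t] alpha_nonneg[OF t] by (auto intro: power_mono)

lemma primitive_has_derivative:
  assumes "b \<in> band t0 \<alpha> \<beta>" "t \<ge> t0"
  shows "(primitive b has_real_derivative b t) (at t within {t0..})"
  using LBINT_has_real_derivative[OF band_cont assms(2)] assms(1) unfolding primitive_def by blast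

lemma primitive_cont:
  assumes "b \<in> band t0 \<alpha> \<beta>"
  shows "continuous_on {t0..} (primitive b)"
  by (rule DERIV_continuous_on) (use primitive_has_derivative[OF assms] in auto)

lemma integrand_cont:
  assumes "b \<in> band t0 \<alpha> \<beta>"
  shows "continuous_on {t0..} (integrand t0 u0 F b)"
  unfolding integrand_primitive
  by (intro continuous_intros primitive_cont[OF assms] continuous_on_compose2[OF F_cont]) auto

lemma rate_cont: "b \<in> band t0 \<alpha> \<beta> \<Longrightarrow> continuous_on {t0..} (rate b)"
  unfolding rate_def by (intro continuous_intros band_cont integrand_cont) (use u0_pos in auto)

lemma integrand_nonneg: "s \<ge> t0 \<Longrightarrow> integrand t0 u0 F b s \<ge> 0"
  by (simp add: integrand_primitive F_nonneg)

lemma rate_nonneg: "s \<ge> t0 \<Longrightarrow> rate b s \<ge> 0"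
  using u0_pos integrand_nonneg[of s b] by (simp add: rate_def)

lemma square_integrable:
  assumes b: "b \<in> band t0 \<alpha> \<beta>" and t: "t \<ge> t0"
  shows "set_integrable lborel {t..} (\<lambda>s. (b s)\<^sup>2)"
proof (rule set_integrable_bound[OF L2_on_square_integrable[OF beta_L2 t]])
  have "continuous_on {t..} (\<lambda>s. (b s)\<^sup>2)"
    by (rule continuous_on_subset[OF continuous_on_power[OF band_cont[OF b]]]) (use t in auto)
  then have "(\<lambda>s. indicator {t..} s *\<^sub>R (b s)\<^sup>2) \<in> borel_measurable borel"
    by (intro borel_measurable_continuous_on_indicator) auto
  then show "set_borel_measurable lborel {t..} (\<lambda>s. (b s)\<^sup>2)"
    by (simp add: set_borel_measurable_def)
  show "AE s in lborel. s \<in> {t..} \<longrightarrow> norm ((b s)\<^sup>2) \<le> norm ((\<beta> s)\<^sup>2)"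
    using band_square[OF b] t by (intro AE_I2) auto
qed

lemma rate_integrable:
  assumes "b \<in> band t0 \<alpha> \<beta>" "t \<ge> t0"
  shows "set_integrable lborel {t..} (rate b)"
  unfolding rate_def using square_integrable[OF assms] tail_bounds[OF assms] by auto

lemma riccati_split:
  assumes "b \<in> band t0 \<alpha> \<beta>" "t0 \<le> s" "s \<le> t"
  shows "riccati b s = (LBINT r:{s..t}. rate b r) + riccati b t"
proof -
  have "{s..} = {s..t} \<union> {t..}"
    using assms(3) by auto
  moreover have "AE r in lborel. \<not> (r \<in> {s..t} \<and> r \<in> {t..})"
    using AE_lborel_singleton[of t] by eventually_elim auto
  moreover have "set_integrable lborel {s..t} (rate b)"
    by (rule set_integrable_subset[OF rate_integrable[OF assms(1,2)]]) auto
  moreover have "set_integrable lborel {t..} (rate b)"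
    using assms by (intro rate_integrable) auto
  ultimately show ?thesis
    unfolding riccati_def by (simp add: set_integral_Un_AE)
qed

text \<open>
  The bounds on the tail integrals are designed for this: \<open>B_bound\<close> differs from \<open>\<alpha>\<close> and \<open>\<beta>\<close> by the
  integrals of their squares, between which the integral of \<open>b\<^sup>2\<close> lies.
\<close>

lemma riccati_range:
  assumes b: "b \<in> band t0 \<alpha> \<beta>" and t: "t \<ge> t0"
  shows "riccati b t \<in> {\<alpha> t..\<beta> t}"
proof -
  have int: "set_integrable lborel {t..} (\<lambda>s. integrand t0 u0 F b s / u0)"
    using tail_bounds[OF b t] by auto
  have "riccati b t = (LBINT s:{t..}. (b s)\<^sup>2) + 1 / u0 * (LBINT s:{t..}. integrand t0 u0 F b s)"
    unfolding riccati_def rate_def by (subst set_integral_add(2)[OF square_integrable[OF b t] int]) simp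
  moreover have "(LBINT s:{t..}. (\<alpha> s)\<^sup>2) \<le> (LBINT s:{t..}. (b s)\<^sup>2)"
    using t by (intro set_integral_mono L2_on_square_integrable[OF alpha_L2] square_integrable b band_square) auto
  moreover have "(LBINT s:{t..}. (b s)\<^sup>2) \<le> (LBINT s:{t..}. (\<beta> s)\<^sup>2)"
    using t by (intro set_integral_mono L2_on_square_integrable[OF beta_L2] square_integrable b band_square) auto
  ultimately show ?thesis
    using tail_bounds[OF b t] by (auto simp: B_bound_def)
qed

lemma beta_bounded:
  obtains K where "K > 0" "\<And>t. t \<ge> t0 \<Longrightarrow> \<beta> t \<le> K"
proof -
  have "\<forall>\<^sub>F t in at_top. \<beta> t < 1"
    using order_tendstoD(2)[OF beta_lim, of 1] by simp
  then obtain R where R: "\<And>t. t \<ge> R \<Longrightarrow> \<beta> t < 1"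
    by (auto simp: eventually_at_top_linorder)
  have "compact (\<beta> ` {t0..R})"
    by (rule compact_continuous_image[OF continuous_on_subset[OF beta_cont]]) auto
  then have "bdd_above (\<beta> ` {t0..R})"
    by (intro bounded_imp_bdd_above compact_imp_bounded)
  then obtain M where "\<forall>y\<in>\<beta> ` {t0..R}. y \<le> M"
    unfolding bdd_above_def by blast
  then have M: "\<beta> t \<le> M" if "t \<in> {t0..R}" for t
    using that by blast
  show ?thesis
  proof (rule that[of "max 1 M"])
    show "\<beta> t \<le> max 1 M" if "t \<ge> t0" for t
      using R[of t] M[of t] that by (cases "t \<ge> R") auto
  qed auto
qed

text \<open>
  Over a short interval \<open>b\<^sup>2\<close> contributes at most its length times a bound for \<open>\<beta>\<^sup>2\<close>, and the other
  part of \<open>rate b\<close> contributes at most \<open>\<gamma>\<close>. Neither estimate depends on \<open>b\<close>.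
\<close>

lemma riccati_equicontinuous:
  assumes "\<epsilon> > 0"
  shows "\<exists>\<delta>>0. \<forall>b\<in>band t0 \<alpha> \<beta>. \<forall>s\<ge>t0. \<forall>t\<ge>t0. \<bar>t - s\<bar> < \<delta> \<longrightarrow> \<bar>riccati b t - riccati b s\<bar> < \<epsilon>"
proof -
  obtain K where "K > 0" and K: "\<And>t. t \<ge> t0 \<Longrightarrow> \<beta> t \<le> K"
    by (rule beta_bounded) auto
  obtain \<zeta> where \<zeta>: "0 < \<zeta>" "\<zeta> < p"
    and small: "\<And>t1 t2. (t1, t2) \<in> Gamma_set t0 p \<Longrightarrow> 0 \<le> t2 - t1 \<Longrightarrow> t2 - t1 \<le> \<zeta> \<Longrightarrow> \<gamma> (t1, t2) < \<epsilon> / 2"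
    using gamma_small[of "\<epsilon> / 2"] assms by auto
  define \<delta> where "\<delta> = min \<zeta> (\<epsilon> / (2 * K\<^sup>2))"
  have "\<delta> > 0" using \<zeta> assms \<open>K > 0\<close> by (simp add: \<delta>_def)
  have incr: "\<bar>riccati b t - riccati b s\<bar> < \<epsilon>" if b: "b \<in> band t0 \<alpha> \<beta>" and s: "t0 \<le> s" "s \<le> t" "t - s < \<delta>" for b s t
  proof -
    have sub: "continuous_on {s..t} g" if "continuous_on {t0..} g" for g :: "real \<Rightarrow> real"
      using that by (rule continuous_on_subset) (use s in auto)
    have int1: "set_integrable lborel {s..t} (\<lambda>r. (b r)\<^sup>2)"
      by (intro borel_integrable_atLeastAtMost' sub continuous_intros band_cont b)
    have int2: "set_integrable lborel {s..t} (\<lambda>r. integrand t0 u0 F b r / u0)"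
      using borel_integrable_atLeastAtMost'[OF sub[OF integrand_cont[OF b]]] by auto
    have G: "(s, t) \<in> Gamma_set t0 p"
      using s \<zeta> by (auto simp: Gamma_set_def \<delta>_def)
    have "riccati b s - riccati b t = (LBINT r:{s..t}. rate b r)"
      using riccati_split[OF b s(1,2)] by simp
    also have "\<dots> = (LBINT r:{s..t}. (b r)\<^sup>2) + 1 / u0 * (LBINT r:{s..t}. integrand t0 u0 F b r)"
      unfolding rate_def by (subst set_integral_add(2)[OF int1 int2]) simp
    also have "(LBINT r:{s..t}. (b r)\<^sup>2) \<le> (LBINT r:{s..t}. K\<^sup>2)"
    proof (intro set_integral_mono int1 borel_integrable_atLeastAtMost' power_mono continuous_on_const)
      fix r assume "r \<in> {s..t}"
      then show "b r \<le> K" "0 \<le> b r"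
        using band_range[OF b, of r] K[of r] s by auto
    qed
    also have "(LBINT r:{s..t}. K\<^sup>2) = K\<^sup>2 * (t - s)"
      using s by (simp add: set_lebesgue_integral_def)
    also have "1 / u0 * (LBINT r:{s..t}. integrand t0 u0 F b r) \<le> \<gamma> (s, t)"
      by (rule gamma_bound[OF b G])
    also have "\<gamma> (s, t) < \<epsilon> / 2"
      using s by (intro small G) (auto simp: \<delta>_def)
    also have "K\<^sup>2 * (t - s) \<le> K\<^sup>2 * (\<epsilon> / (2 * K\<^sup>2))"
      using s by (intro mult_left_mono) (auto simp: \<delta>_def)
    also have "\<dots> = \<epsilon> / 2" using \<open>K > 0\<close> by simp
    finally have "riccati b s - riccati b t < \<epsilon>" by simp
    moreover have "(LBINT r:{s..t}. rate b r) \<ge> 0"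
      unfolding set_lebesgue_integral_def using s rate_nonneg
      by (intro Bochner_Integration.integral_nonneg) (auto simp: indicator_def)
    ultimately show ?thesis
      using riccati_split[OF b s(1,2)] by simp
  qed
  show ?thesis
  proof (intro exI[of _ \<delta>] conjI ballI allI impI \<open>\<delta> > 0\<close>)
    fix b s t assume "b \<in> band t0 \<alpha> \<beta>" "t0 \<le> s" "t0 \<le> t" "\<bar>t - s\<bar> < \<delta>"
    then show "\<bar>riccati b t - riccati b s\<bar> < \<epsilon>"
    proof (cases "s \<le> t")
      case True
      with \<open>\<bar>t - s\<bar> < \<delta>\<close> have "t - s < \<delta>" by linarith
      with True \<open>b \<in> band t0 \<alpha> \<beta>\<close> \<open>t0 \<le> s\<close> show ?thesis by (intro incr)
    next
      case False
      with \<open>\<bar>t - s\<bar> < \<delta>\<close> have "t \<le> s" "s - t < \<delta>" by linarith+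
      with \<open>b \<in> band t0 \<alpha> \<beta>\<close> \<open>t0 \<le> t\<close> have "\<bar>riccati b s - riccati b t\<bar> < \<epsilon>" by (intro incr)
      then show ?thesis by linarith
    qed
  qed
qed

lemma primitive_tendsto:
  assumes B: "\<And>n. B n \<in> band t0 \<alpha> \<beta>" and b: "b \<in> band t0 \<alpha> \<beta>"
    and lim: "\<And>t. t \<ge> t0 \<Longrightarrow> (\<lambda>n. B n t) \<longlonglongrightarrow> b t"
  shows "(\<lambda>n. primitive (B n) s) \<longlonglongrightarrow> primitive b s"
proof -
  obtain K where "K > 0" and K: "\<And>t. t \<ge> t0 \<Longrightarrow> \<beta> t \<le> K"
    by (rule beta_bounded) auto
  show ?thesis
    unfolding primitive_def
  proof (rule LBINT_bounded_convergence)
    show "continuous_on {t0..s} (B n)" for n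
      by (rule continuous_on_subset[OF band_cont[OF B]]) auto
    show "continuous_on {t0..s} b"
      by (rule continuous_on_subset[OF band_cont[OF b]]) auto
    show "\<bar>B n r\<bar> \<le> K" if "r \<in> {t0..s}" for n r
      using band_range[OF B, of r n] K[of r] that by auto
  qed (use lim in auto)
qed

lemma primitive_bounds:
  assumes b: "b \<in> band t0 \<alpha> \<beta>" and K: "\<And>t. t \<ge> t0 \<Longrightarrow> \<beta> t \<le> K" and "K > 0" and s: "t0 \<le> s" "s \<le> R"
  shows "primitive b s \<in> {0..K * (R - t0)}"
proof -
  have int: "set_integrable lborel {t0..s} b"
    by (rule borel_integrable_atLeastAtMost'[OF continuous_on_subset[OF band_cont[OF b]]]) auto
  have "primitive b s \<ge> 0"
    unfolding primitive_def set_lebesgue_integral_def using band_range[OF b]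
    by (intro Bochner_Integration.integral_nonneg) (auto simp: indicator_def)
  moreover have "primitive b s \<le> (LBINT r:{t0..s}. K)"
    unfolding primitive_def
  proof (intro set_integral_mono int borel_integrable_atLeastAtMost' continuous_on_const)
    fix r assume "r \<in> {t0..s}"
    then show "b r \<le> K"
      using band_range[OF b, of r] K[of r] by auto
  qed
  moreover have "(LBINT r:{t0..s}. K) = K * (s - t0)"
    using s by (simp add: set_lebesgue_integral_def)
  moreover have "K * (s - t0) \<le> K * (R - t0)"
    using s \<open>K > 0\<close> by (intro mult_left_mono) auto
  ultimately show ?thesis by auto
qed

text \<open>
  On \<open>{t0..R}\<close> the primitives of all members of the band take values in one compact interval, so \<open>F\<close>
  is evaluated on a compact set only.
\<close>

lemma rate_bounded:
  obtains C where "\<And>b s. b \<in> band t0 \<alpha> \<beta> \<Longrightarrow> s \<in> {t0..R} \<Longrightarrow> \<bar>rate b s\<bar> \<le> C"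
proof -
  obtain K where "K > 0" and K: "\<And>t. t \<ge> t0 \<Longrightarrow> \<beta> t \<le> K"
    by (rule beta_bounded) auto
  define L where "L = K * (R - t0)"
  define Q where "Q = {t0..R} \<times> {0..L}"
  define f where "f z = F (fst z, u0 * exp (snd z)) * exp (- snd z)" for z
  have "continuous_on Q f"
    unfolding f_def Q_def
    by (intro continuous_intros continuous_on_compose2[OF F_cont]) auto
  moreover have "compact Q"
    unfolding Q_def by (intro compact_Times compact_Icc)
  ultimately have "bounded (f ` Q)"
    by (intro compact_imp_bounded compact_continuous_image)
  then obtain M where M: "\<And>z. z \<in> Q \<Longrightarrow> \<bar>f z\<bar> \<le> M"
    unfolding bounded_iff by (metis imageI real_norm_def)
  show ?thesis
  proof (rule that[of "K\<^sup>2 + M / u0"])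
    fix b s assume b: "b \<in> band t0 \<alpha> \<beta>" and s: "s \<in> {t0..R}"
    have "(s, primitive b s) \<in> Q"
      using primitive_bounds[OF b K \<open>K > 0\<close>, of s R] s by (auto simp: Q_def L_def)
    then have "integrand t0 u0 F b s \<le> M"
      using M[of "(s, primitive b s)"] by (simp add: f_def integrand_primitive)
    moreover have "(b s)\<^sup>2 \<le> K\<^sup>2"
      using band_range[OF b, of s] K[of s] s by (intro power_mono) auto
    ultimately have "rate b s \<le> K\<^sup>2 + M / u0"
      unfolding rate_def using u0_pos by (intro add_mono divide_right_mono) auto
    then show "\<bar>rate b s\<bar> \<le> K\<^sup>2 + M / u0"
      using rate_nonneg[of s b] s by auto
  qed
qed

lemma rate_tendsto:
  assumes B: "\<And>n. B n \<in> band t0 \<alpha> \<beta>" and b: "b \<in> band t0 \<alpha> \<beta>"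
    and lim: "\<And>t. t \<ge> t0 \<Longrightarrow> (\<lambda>n. B n t) \<longlonglongrightarrow> b t" and s: "s \<ge> t0"
  shows "(\<lambda>n. rate (B n) s) \<longlonglongrightarrow> rate b s"
proof -
  have prim: "(\<lambda>n. primitive (B n) s) \<longlonglongrightarrow> primitive b s"
    by (rule primitive_tendsto[OF B b lim])
  have "continuous_on UNIV (\<lambda>y. F (s, u0 * exp y))"
    by (intro continuous_on_compose2[OF F_cont] continuous_intros) (use s in auto)
  then have "(\<lambda>n. F (s, u0 * exp (primitive (B n) s))) \<longlonglongrightarrow> F (s, u0 * exp (primitive b s))"
    by (rule continuous_on_tendsto_compose[OF _ prim]) auto
  then show ?thesis
    unfolding rate_def integrand_primitive by (intro tendsto_intros prim lim s) (use u0_pos in auto)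
qed

text \<open>
  The hypotheses bound the tail integrals of the \<open>rate (B n)\<close> but give no common integrable bound for
  these functions, so dominated convergence does not apply on the half-line. But the part of the integral beyond \<open>R\<close> is the value of the operator at \<open>R\<close>, which is between \<open>0\<close> and \<open>\<beta> R\<close> and thus
  uniformly small for large \<open>R\<close>; bounded convergence takes care of the part before \<open>R\<close>.
\<close>

lemma riccati_tendsto:
  assumes B: "\<And>n. B n \<in> band t0 \<alpha> \<beta>" and b: "b \<in> band t0 \<alpha> \<beta>"
    and lim: "\<And>t. t \<ge> t0 \<Longrightarrow> (\<lambda>n. B n t) \<longlonglongrightarrow> b t" and t: "t \<ge> t0"
  shows "(\<lambda>n. riccati (B n) t) \<longlonglongrightarrow> riccati b t"
proof (rule LIMSEQ_I, unfold real_norm_def)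
  fix e :: real assume "e > 0"
  have "\<forall>\<^sub>F R in at_top. \<beta> R < e / 3 \<and> R \<ge> t"
    using order_tendstoD(2)[OF beta_lim, of "e / 3"] \<open>e > 0\<close> eventually_ge_at_top[of t]
    by (auto intro: eventually_conj)
  then obtain R where R: "\<beta> R < e / 3" "R \<ge> t"
    by (auto dest: eventually_happens)
  have tail: "0 \<le> riccati c R \<and> riccati c R < e / 3" if "c \<in> band t0 \<alpha> \<beta>" for c
    using riccati_range[OF that, of R] alpha_nonneg[of R] R t by auto
  obtain C where C: "\<And>b s. b \<in> band t0 \<alpha> \<beta> \<Longrightarrow> s \<in> {t0..R} \<Longrightarrow> \<bar>rate b s\<bar> \<le> C"
    by (rule rate_bounded[of R]) blast
  have "(\<lambda>n. LBINT s:{t..R}. rate (B n) s) \<longlonglongrightarrow> (LBINT s:{t..R}. rate b s)"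
  proof (rule LBINT_bounded_convergence)
    show "continuous_on {t..R} (rate (B n))" for n
      by (rule continuous_on_subset[OF rate_cont[OF B]]) (use t in auto)
    show "continuous_on {t..R} (rate b)"
      by (rule continuous_on_subset[OF rate_cont[OF b]]) (use t in auto)
    show "(\<lambda>n. rate (B n) s) \<longlonglongrightarrow> rate b s" if "s \<in> {t..R}" for s
      by (rule rate_tendsto[OF B b lim]) (use that t in auto)
    show "\<bar>rate (B n) s\<bar> \<le> C" if "s \<in> {t..R}" for n s
      using C[OF B] that t by auto
  qed
  then obtain M where M: "\<And>n. n \<ge> M \<Longrightarrow> \<bar>(LBINT s:{t..R}. rate (B n) s) - (LBINT s:{t..R}. rate b s)\<bar> < e / 3"
    using LIMSEQ_D[of "\<lambda>n. LBINT s:{t..R}. rate (B n) s" _ "e / 3"] \<open>e > 0\<close>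
    unfolding real_norm_def by (metis zero_less_divide_iff zero_less_numeral)
  have "\<bar>riccati (B n) t - riccati b t\<bar> < e" if "n \<ge> M" for n
    using M[OF that] tail[OF B, of n] tail[OF b] riccati_split[OF B t R(2), of n] riccati_split[OF b t R(2)]
    by linarith
  then show "\<exists>M. \<forall>n\<ge>M. \<bar>riccati (B n) t - riccati b t\<bar> < e" by blast
qed

lemma riccati_fixed_point:
  obtains b where "b \<in> band t0 \<alpha> \<beta>" and "\<And>t. t \<ge> t0 \<Longrightarrow> riccati b t = b t"
  by (rule band_fixed_point[of t0 \<alpha> \<beta> riccati])
    (use alpha_cont beta_cont alpha_le_beta riccati_range riccati_equicontinuous riccati_tendsto in blast)+

lemma fixed_point_has_derivative:
  assumes b: "b \<in> band t0 \<alpha> \<beta>" and fixed: "\<And>t. t \<ge> t0 \<Longrightarrow> riccati b t = b t" and t: "t \<ge> t0"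
  shows "(b has_real_derivative - rate b t) (at t within {t0..})"
proof -
  have "((\<lambda>x. b t0 - (LBINT s:{t0..x}. rate b s)) has_real_derivative - rate b t) (at t within {t0..})"
    by (auto intro!: derivative_eq_intros LBINT_has_real_derivative rate_cont b t)
  moreover have "b t0 - (LBINT s:{t0..x}. rate b s) = b x" if "x \<ge> t0" for x
    using riccati_split[OF b order_refl that] fixed[OF that] fixed[of t0] by simp
  ultimately show ?thesis
    using t by (auto intro: has_field_derivative_transform_within[OF _ zero_less_one])
qed

lemma fixed_point_solution:
  assumes b: "b \<in> band t0 \<alpha> \<beta>" and fixed: "\<And>t. t \<ge> t0 \<Longrightarrow> riccati b t = b t"
  defines "u \<equiv> \<lambda>t. u0 * exp (primitive b t)"
  shows "is_solution t0 p u0 F \<alpha> \<beta> \<gamma> u (\<lambda>t. u t * b t) (\<lambda>t. - F (t, u t))"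
    and "(\<lambda>t. u t * b t / u t) \<in> band t0 \<alpha> \<beta>"
proof -
  have u_pos: "u t > 0" for t
    using u0_pos by (simp add: u_def)
  have log_deriv: "u t * b t / u t = b t" for t
    using u_pos[of t] by simp
  have F_u: "integrand t0 u0 F b t / u0 = F (t, u t) / u t" for t
    using u0_pos by (simp add: integrand_primitive u_def exp_minus field_simps)
  have u_deriv: "(u has_real_derivative u t * b t) (at t within {t0..})" if "t \<ge> t0" for t
    unfolding u_def by (auto intro!: derivative_eq_intros primitive_has_derivative[OF b that])
  have u'_deriv: "((\<lambda>t. u t * b t) has_real_derivative - F (t, u t)) (at t within {t0..})" if "t \<ge> t0" for t
  proof -
    have "((\<lambda>t. u t * b t) has_real_derivative u t * b t * b t + - rate b t * u t) (at t within {t0..})"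
      using DERIV_mult[OF u_deriv[OF that] fixed_point_has_derivative[OF b fixed that]] by simp
    moreover have "u t * b t * b t + - rate b t * u t = - F (t, u t)"
      using u_pos[of t] by (simp add: rate_def F_u power2_eq_square field_simps)
    ultimately show ?thesis by simp
  qed
  have "continuous_on {t0..} (\<lambda>t. - F (t, u t))"
    by (intro continuous_intros continuous_on_compose2[OF F_cont] DERIV_continuous_on[of _ u]) (use u_deriv in auto)
  moreover have "(LBINT s:{t1..t2}. F (s, u s) / u s) \<le> \<gamma> (t1, t2)" if "(t1, t2) \<in> Gamma_set t0 p" for t1 t2
    using gamma_bound[OF b that] by (simp flip: F_u)
  moreover have "u t0 = u0"
  proof -
    obtain K where "K > 0" "\<And>t. t \<ge> t0 \<Longrightarrow> \<beta> t \<le> K"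
      by (rule beta_bounded) auto
    then show ?thesis
      using primitive_bounds[OF b, of K t0 t0] by (simp add: u_def)
  qed
  ultimately show "is_solution t0 p u0 F \<alpha> \<beta> \<gamma> u (\<lambda>t. u t * b t) (\<lambda>t. - F (t, u t))"
    using u_deriv u'_deriv u_pos band_range[OF b]
    unfolding is_solution_def C2_from_def log_deriv by auto
  show "(\<lambda>t. u t * b t / u t) \<in> band t0 \<alpha> \<beta>"
    using b by (simp add: log_deriv)
qed

end

section \<open>Existence of positive solutions\<close>

theorem theorem1:
  fixes t0 p u0 :: real
    and F :: "real \<times> real \<Rightarrow> real"
    and \<alpha> \<beta> :: "real \<Rightarrow> real"
    and \<gamma> :: "real \<times> real \<Rightarrow> real"
  assumes "t0 > 0" and "p > 0" and "u0 > 0"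
    and F_cont: "continuous_on ({t0..} \<times> UNIV) F"
    and F_nonneg: "\<And>t x. t \<ge> t0 \<Longrightarrow> F (t, x) \<ge> 0"
    and alpha_cont: "continuous_on {t0..} \<alpha>"
    and alpha_nonneg: "\<And>t. t \<ge> t0 \<Longrightarrow> \<alpha> t \<ge> 0"
    and beta_cont: "continuous_on {t0..} \<beta>"
    and beta_nonneg: "\<And>t. t \<ge> t0 \<Longrightarrow> \<beta> t \<ge> 0"
    and gamma_cont: "continuous_on (Gamma_set t0 p) \<gamma>"
    and gamma_nonneg: "\<And>z. z \<in> Gamma_set t0 p \<Longrightarrow> \<gamma> z \<ge> 0"
    and alpha_le_beta: "\<And>t. t \<ge> t0 \<Longrightarrow> \<alpha> t \<le> \<beta> t"
    and i_lim: "(\<alpha> \<longlongrightarrow> 0) at_top" "(\<beta> \<longlongrightarrow> 0) at_top"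
    and i_L2: "L2_on {t0<..} \<alpha>" "L2_on {t0<..} \<beta>"
    and ii: "\<And>\<epsilon>. \<epsilon> > 0 \<Longrightarrow> \<exists>\<zeta>. 0 < \<zeta> \<and> \<zeta> < p \<and>
        (\<forall>(t1, t2)\<in>Gamma_set t0 p. 0 \<le> t2 - t1 \<and> t2 - t1 \<le> \<zeta> \<longrightarrow> \<gamma> (t1, t2) < \<epsilon>)"
    and iii: "\<And>b t. b \<in> band t0 \<alpha> \<beta> \<Longrightarrow> t \<ge> t0 \<Longrightarrow>
        set_integrable lborel {t..} (integrand t0 u0 F b) \<and>
        B_bound \<alpha> t \<le> 1 / u0 * (LBINT s:{t..}. integrand t0 u0 F b s) \<and>
        1 / u0 * (LBINT s:{t..}. integrand t0 u0 F b s) \<le> B_bound \<beta> t"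
    and iv: "\<And>b t1 t2. b \<in> band t0 \<alpha> \<beta> \<Longrightarrow> (t1, t2) \<in> Gamma_set t0 p \<Longrightarrow>
        1 / u0 * (LBINT s:{t1..t2}. integrand t0 u0 F b s) \<le> \<gamma> (t1, t2)"
  shows "\<exists>u u' u''. is_solution t0 p u0 F \<alpha> \<beta> \<gamma> u u' u'' \<and>
           (\<lambda>t. u' t / u t) \<in> band t0 \<alpha> \<beta>"
proof -
  interpret riccati_band t0 p u0 F \<alpha> \<beta> \<gamma>
    by unfold_locales (fact assms)+
  obtain b where "b \<in> band t0 \<alpha> \<beta>" "\<And>t. t \<ge> t0 \<Longrightarrow> riccati b t = b t"
    by (rule riccati_fixed_point) blast
  then show ?thesis
    using fixed_point_solution by blast
qed

end
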